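(* Let $A\in\mathbb{R}^{m\times n}$ and $B\in\mathbb{R}^{n\times k}$, let $P$ be the orthogonal projection of $\mathbb{R}^n$ onto $\mathcal N(A)$, and let $R=B(PB)^+$. If $\mathcal R(PB)=\mathcal N(A)$, then $$PR=P\qquad\text{and}\qquad RP=R.$$
   Context: $\mathcal N$ and $\mathcal R$ denote null space and range, and $X^+$ the Moore–Penrose pseudo-inverse. When $B^TPB$ is invertible, $(PB)^+=(B^TPB)^{-1}B^TP$, so that $R=B(B^TPB)^{-1}B^TP$. *)

theory Defs
  imports "HOL-Analysis.Analysis"
begin

definition null_space :: "real^'n^'m \<Rightarrow> (real^'n) set" where
  "null_space A = {x. A *v x = 0}"

definition range_space :: "real^'n^'m \<Rightarrow> (real^'m) set" where
  "range_space A = range (\<lambda>x. A *v x)"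

definition is_orthogonal_projection :: "real^'n^'n \<Rightarrow> (real^'n) set \<Rightarrow> bool" where
  "is_orthogonal_projection P S \<longleftrightarrow>
     (\<forall>x. P *v x \<in> S \<and> (\<forall>z\<in>S. orthogonal (x - P *v x) z))"

(* The four Penrose equations. *)
definition is_pseudo_inverse :: "real^'n^'m \<Rightarrow> real^'m^'n \<Rightarrow> bool" where
  "is_pseudo_inverse M X \<longleftrightarrow>
     M ** X ** M = M \<and> X ** M ** X = X \<and>
     transpose (M ** X) = M ** X \<and> transpose (X ** M) = X ** M"

(* Well-defined by ex1_pseudo_inverse below. *)
definition pseudo_inverse :: "real^'n^'m \<Rightarrow> real^'m^'n" where
  "pseudo_inverse M = (THE X. is_pseudo_inverse M X)"

lemma ex1_orthogonal_projection:
  fixes S :: "(real^'n) set"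
  assumes S: "subspace S"
  shows "\<exists>!P. is_orthogonal_projection P S"
proof -
  define Q where "Q x y \<longleftrightarrow> y \<in> S \<and> (\<forall>z\<in>S. orthogonal (x - y) z)" for x y :: "real^'n"
  have uniq: "y = y'" if "Q x y" "Q x y'" for x y y'
  proof -
    have "y - y' \<in> S" using that S by (simp add: Q_def subspace_diff)
    then have "(x - y') \<bullet> (y - y') = 0" "(x - y) \<bullet> (y - y') = 0"
      using that by (auto simp: Q_def orthogonal_def)
    then have "(y - y') \<bullet> (y - y') = 0" by (simp add: inner_diff_left)
    then show ?thesis by simp
  qed
  have "\<exists>y. Q x y" for x
  proof -
    obtain y z where "y \<in> span S" "\<And>w. w \<in> span S \<Longrightarrow> orthogonal z w" "x = y + z"
      using orthogonal_subspace_decomp_exists[of S x] by blast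
    then show ?thesis using S by (auto simp: Q_def span_eq_iff[THEN iffD2])
  qed
  then obtain f where f: "\<And>x. Q x (f x)" by metis
  have "linear f"
  proof (rule linearI)
    show "f (x + y) = f x + f y" for x y
      using f[of x] f[of y] S
      by (intro uniq[OF f]) (auto simp: Q_def subspace_add orthogonal_def algebra_simps)
    show "f (c *\<^sub>R x) = c *\<^sub>R f x" for c x
      using f[of x] S
      by (intro uniq[OF f])
        (auto simp: Q_def subspace_scale orthogonal_def inner_diff_left)
  qed
  then have "is_orthogonal_projection (matrix f) S"
    using f by (simp add: is_orthogonal_projection_def Q_def matrix_works)
  moreover have "P = P'" if "is_orthogonal_projection P S" "is_orthogonal_projection P' S" for P P'
    using that uniq unfolding is_orthogonal_projection_def Q_def matrix_eq by blast
  ultimately show ?thesis by blast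
qed

lemma transpose_orthogonal_projection:
  assumes "is_orthogonal_projection P S"
  shows "transpose P = P"
proof -
  have eq: "(P *v x) \<bullet> y = (P *v x) \<bullet> (P *v y)" for x y
  proof -
    have "(y - P *v y) \<bullet> (P *v x) = 0"
      using assms by (simp add: is_orthogonal_projection_def orthogonal_def)
    then show ?thesis by (simp add: inner_diff_left) (simp add: inner_commute)
  qed
  have "x \<bullet> (transpose P *v y) = x \<bullet> (P *v y)" for x y
  proof -
    have "x \<bullet> (transpose P *v y) = (P *v x) \<bullet> y"
      by (metis dot_lmul_matrix inner_commute transpose_matrix_vector)
    also have "\<dots> = (P *v y) \<bullet> x"
      using eq[of x y] eq[of y x] by (simp add: inner_commute)
    finally show ?thesis by (simp add: inner_commute)
  qed
  then show ?thesis by (metis matrix_eq vector_eq_ldot)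
qed

lemma orthogonal_projection_ident:
  assumes "is_orthogonal_projection P S" "subspace S" "x \<in> S"
  shows "P *v x = x"
proof -
  have "x - P *v x \<in> S"
    using assms by (simp add: is_orthogonal_projection_def subspace_diff)
  then have "orthogonal (x - P *v x) (x - P *v x)"
    using assms(1) by (simp add: is_orthogonal_projection_def)
  then show ?thesis by (simp add: orthogonal_def)
qed

lemma ex1_pseudo_inverse: "\<exists>!X. is_pseudo_inverse M X"
proof (rule ex_ex1I)
  have sV: "subspace (range_space M)"
    unfolding range_space_def by (intro linear_subspace_image) auto
  have sW: "subspace (range_space (transpose M))"
    unfolding range_space_def by (intro linear_subspace_image) auto
  obtain V where V: "is_orthogonal_projection V (range_space M)"
    using ex1_orthogonal_projection[OF sV] by blast
  obtain W where W: "is_orthogonal_projection W (range_space (transpose M))"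
    using ex1_orthogonal_projection[OF sW] by blast
  obtain g where g: "linear g" "\<And>v. v \<in> range_space M \<Longrightarrow> M *v g v = v"
    using linear_exists_right_inverse_on[of "(*v) M" UNIV] by (auto simp: range_space_def)
  define G where "G = matrix g"
  have G: "M *v (G *v v) = v" if "v \<in> range_space M" for v
    using g that by (simp add: G_def matrix_works)
  have VM: "V ** M = M"
    unfolding matrix_eq
    by (auto simp flip: matrix_vector_mul_assoc simp: range_space_def
        intro!: orthogonal_projection_ident[OF V sV])
  have WM: "W ** transpose M = transpose M"
    unfolding matrix_eq
    by (auto simp flip: matrix_vector_mul_assoc simp: range_space_def
        intro!: orthogonal_projection_ident[OF W sW])
  then have MW: "M ** W = M"
    by (metis matrix_transpose_mul transpose_transpose transpose_orthogonal_projection[OF W])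
  have MGV: "M ** G ** V = V"
    unfolding matrix_eq using V
    by (auto simp flip: matrix_vector_mul_assoc simp: is_orthogonal_projection_def G)
  have MGM: "M ** G ** M = M"
    unfolding matrix_eq
    by (auto simp flip: matrix_vector_mul_assoc simp: range_space_def G)
  have W0: "W *v x = 0" if "M *v x = 0" for x
  proof -
    obtain u where u: "W *v x = transpose M *v u"
      using W by (auto simp: is_orthogonal_projection_def range_space_def)
    have "M *v (W *v x) = 0" using MW that by (simp add: matrix_vector_mul_assoc)
    then have "(transpose M *v u) \<bullet> (W *v x) = 0"
      by (metis dot_lmul_matrix inner_zero_right transpose_matrix_vector)
    then show ?thesis by (simp add: u)
  qed
  have WGM: "W ** G ** M = W"
  proof -
    have "W *v (G *v (M *v x) - x) = 0" for x
      using MGM by (intro W0) (metis diff_self matrix_vector_mul_assoc matrix_vector_mult_diff_distrib)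
    then show ?thesis
      by (simp add: matrix_eq matrix_vector_mult_diff_distrib flip: matrix_vector_mul_assoc)
  qed
  define X where "X = W ** G ** V"
  have MX: "M ** X = V" using MW MGV by (simp add: X_def matrix_mul_assoc)
  have XM: "X ** M = W" using VM WGM by (simp add: X_def flip: matrix_mul_assoc)
  have "W ** X = X"
  proof -
    have "W ** W = W"
      unfolding matrix_eq using W
      by (auto simp flip: matrix_vector_mul_assoc simp: is_orthogonal_projection_def
          intro!: orthogonal_projection_ident[OF W sW])
    then show ?thesis by (simp add: X_def matrix_mul_assoc)
  qed
  then have "is_pseudo_inverse M X"
    using VM transpose_orthogonal_projection[OF V] transpose_orthogonal_projection[OF W]
    by (simp add: is_pseudo_inverse_def MX XM)
  then show "\<exists>X. is_pseudo_inverse M X" ..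
next
  fix X Y
  assume X: "is_pseudo_inverse M X" and Y: "is_pseudo_inverse M Y"
  have MX: "M ** X = M ** Y"
  proof -
    have "M ** X = transpose (M ** Y ** M ** X)"
      using X Y by (simp add: is_pseudo_inverse_def)
    also have "\<dots> = transpose (M ** X) ** transpose (M ** Y)"
      by (simp add: matrix_mul_assoc flip: matrix_transpose_mul)
    also have "\<dots> = M ** X ** M ** Y"
      using X Y by (simp add: is_pseudo_inverse_def matrix_mul_assoc)
    finally show ?thesis using X by (simp add: is_pseudo_inverse_def)
  qed
  have XM: "X ** M = Y ** M"
  proof -
    have "X ** M = X ** (M ** Y ** M)" using Y by (simp add: is_pseudo_inverse_def)
    also have "\<dots> = (X ** M) ** (Y ** M)" by (simp add: matrix_mul_assoc)
    also have "\<dots> = transpose (X ** M) ** transpose (Y ** M)"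
      using X Y by (simp add: is_pseudo_inverse_def)
    also have "\<dots> = transpose (Y ** (M ** X ** M))"
      by (simp add: matrix_mul_assoc flip: matrix_transpose_mul)
    also have "\<dots> = Y ** M" using X Y by (simp add: is_pseudo_inverse_def)
    finally show ?thesis .
  qed
  have "X = X ** M ** X" using X by (simp add: is_pseudo_inverse_def)
  also have "\<dots> = Y ** M ** X" by (simp add: XM)
  also have "\<dots> = Y ** M ** Y" by (simp add: MX flip: matrix_mul_assoc)
  also have "\<dots> = Y" using Y by (simp add: is_pseudo_inverse_def)
  finally show "X = Y" .
qed

end

theory Submission
  imports Defs
begin

text \<open>For a pseudo-inverse \<open>X\<close> of \<open>M\<close>, the product
  \<open>M ** X\<close> is the orthogonal projection onto the range of \<open>M\<close>
  (\<open>pseudo_inverse_orthogonal_projection\<close>). With \<open>M = P ** B\<close>, whose range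
  is \<open>null_space A\<close>, this projection is \<open>P\<close> itself, which is the first
  identity. The second follows from \<open>X ** M ** X = X\<close>.\<close>

lemma is_pseudo_inverse_pseudo_inverse: "is_pseudo_inverse M (pseudo_inverse M)"
  unfolding pseudo_inverse_def by (rule theI'[OF ex1_pseudo_inverse])

text \<open>By \<open>M ** X ** M = M\<close>, the matrix \<open>M ** X\<close> fixes the range of
  \<open>M\<close>, hence absorbs \<open>P\<close> on its right; likewise \<open>P\<close> absorbs
  \<open>M\<close> on its right. Since \<open>P\<close> and \<open>M ** X\<close> are symmetric,
  transposing the first relation makes both equal to \<open>P ** (M ** X)\<close>.\<close>

lemma pseudo_inverse_orthogonal_projection:
  assumes P: "is_orthogonal_projection P (range_space M)"
    and X: "is_pseudo_inverse M X"
  shows "M ** X = P"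
proof -
  have sM: "subspace (range_space M)"
    unfolding range_space_def by (intro linear_subspace_image) auto
  have MXM: "M ** X ** M = M" and MXt: "transpose (M ** X) = M ** X"
    using X by (simp_all add: is_pseudo_inverse_def)
  have "M *v (X *v v) = v" if "v \<in> range_space M" for v
    using that MXM by (auto simp: range_space_def matrix_vector_mul_assoc matrix_mul_assoc)
  then have MXP: "(M ** X) ** P = P"
    using P by (simp add: matrix_eq is_orthogonal_projection_def flip: matrix_vector_mul_assoc)
  have PM: "P ** M = M"
    unfolding matrix_eq
    by (auto simp flip: matrix_vector_mul_assoc simp: range_space_def
        intro!: orthogonal_projection_ident[OF P sM])
  have "P = transpose ((M ** X) ** P)"
    by (simp only: MXP transpose_orthogonal_projection[OF P])
  also have "\<dots> = P ** (M ** X)"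
    by (simp only: matrix_transpose_mul[of "M ** X" P] MXt transpose_orthogonal_projection[OF P])
  also have "\<dots> = M ** X"
    by (simp add: matrix_mul_assoc PM)
  finally show ?thesis by simp
qed

theorem mainTheorem4:
  fixes A :: "real^'n^'m" and B :: "real^'k^'n" and P R :: "real^'n^'n"
  assumes "is_orthogonal_projection P (null_space A)"
    and "R = B ** pseudo_inverse (P ** B)"
    and "range_space (P ** B) = null_space A"
  shows "P ** R = P \<and> R ** P = R"
proof -
  let ?X = "pseudo_inverse (P ** B)"
  have X: "is_pseudo_inverse (P ** B) ?X"
    by (rule is_pseudo_inverse_pseudo_inverse)
  \<comment> \<open>Up to associativity this is already \<open>P ** R = P\<close>.\<close>
  have P: "P ** B ** ?X = P"
    using assms(1,3) X by (intro pseudo_inverse_orthogonal_projection) simp_all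
  \<comment> \<open>Expanding \<open>P\<close> as \<open>P ** B ** ?X\<close> exposes the second
    Penrose equation; multiplying the result by \<open>B\<close> on the left gives
    \<open>R ** P = R\<close>.\<close>
  have "?X ** P = ?X ** (P ** B) ** ?X"
    by (metis P matrix_mul_assoc)
  also have "\<dots> = ?X"
    using X by (simp add: is_pseudo_inverse_def)
  finally have "?X ** P = ?X" .
  then show ?thesis
    using P assms(2) by (metis matrix_mul_assoc)
qed

end
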